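(* Let $\lambda>0$ and a positive integer $K$ be given. Consider maximizing, over $M$, the energy efficiency metric $$F(M)=\frac{K\gamma}{\frac{K\rho^*}{\eta}+\mathcal{C}_0+\mathcal{C}_1K+\mathcal{D}_0M+\mathcal{D}_1MK+\mathcal{A}K\gamma}\quad\text{subject to}\quad M-K\ge\frac{2^\gamma-1}{1-2^\gamma\epsilon^2}\,\frac{2K}{\alpha-2},$$ where $\rho^*$ depends on $M$ through $$\rho^*=\frac{\frac{2^\gamma-1}{1-2^\gamma\epsilon^2}\,\frac{\omega\sigma^2\,\Gamma(\alpha/2+1)}{(\pi\lambda)^{\alpha/2}}}{M-K-\frac{2^\gamma-1}{1-2^\gamma\epsilon^2}\,\frac{2K}{\alpha-2}}.$$ Over real-valued $M$ satisfying the constraint, $F$ is maximized by $$M^*=K+\frac{2K(2^\gamma-1)}{(\alpha-2)(1-2^\gamma\epsilon^2)}+\sqrt{\frac{2^\gamma-1}{1-2^\gamma\epsilon^2}\,\frac{K\eta^{-1}\omega\sigma^2\,\Gamma(\frac{\alpha}{2}+1)}{(\pi\lambda)^{\alpha/2}(\mathcal{D}_0+\mathcal{D}_1K)}}.$$ If $M^*$ is not an integer, then the optimum over integers $M$ satisfying the constraint is attained at either the closest smaller or the closest larger integer to $M^*$.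
   Context: Fixed parameters: $\alpha>2$, $\omega>0$, $\sigma^2>0$, $0\le\epsilon<1$, $\eta\in(0,1]$, positive constants $\mathcal{A},\mathcal{C}_0,\mathcal{C}_1,\mathcal{D}_0,\mathcal{D}_1$, and a target spectral efficiency $\gamma$ with $0\le\gamma<-2\log_2(\epsilon)$ (upper bound $+\infty$ if $\epsilon=0$), so that $1-2^\gamma\epsilon^2>0$. Here $\lambda$ is the density of access points, $K$ the number of users per access point, $M$ the number of antennas per access point, and $\rho^*$ the transmit energy per symbol. Convention: if the constraint holds with equality (so the denominator of $\rho^*$ vanishes), then $F(M)$ is taken to be $0$. *)

theory Defs
  imports "HOL-Analysis.Gamma_Function"
begin

text \<open>
  Throughout, \<open>lam\<close> is the density of access points, \<open>K\<close> the number of users and \<open>M\<close> the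
  (real-valued) number of antennas per access point.
\<close>

definition sinr_factor :: "real \<Rightarrow> real \<Rightarrow> real" where
  "sinr_factor \<gamma> \<epsilon> = (2 powr \<gamma> - 1) / (1 - 2 powr \<gamma> * \<epsilon>\<^sup>2)"

definition feasible :: "real \<Rightarrow> real \<Rightarrow> real \<Rightarrow> nat \<Rightarrow> real \<Rightarrow> bool" where
  "feasible \<alpha> \<epsilon> \<gamma> K M \<longleftrightarrow>
     M - real K \<ge> sinr_factor \<gamma> \<epsilon> * (2 * real K / (\<alpha> - 2))"

definition rho_star ::
    "real \<Rightarrow> real \<Rightarrow> real \<Rightarrow> real \<Rightarrow> real \<Rightarrow> real \<Rightarrow> nat \<Rightarrow> real \<Rightarrow> real" where
  "rho_star \<alpha> \<omega> \<sigma> \<epsilon> \<gamma> lam K M =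
     (sinr_factor \<gamma> \<epsilon> * (\<omega> * \<sigma>\<^sup>2 * Gamma (\<alpha> / 2 + 1) / (pi * lam) powr (\<alpha> / 2)))
     / (M - real K - sinr_factor \<gamma> \<epsilon> * (2 * real K / (\<alpha> - 2)))"

text \<open>
  If the constraint is tight, the denominator of \<open>rho_star\<close> vanishes and the energy efficiency
  is 0 by convention. The explicit case is needed: Isabelle's \<open>x / 0 = 0\<close> would make \<open>rho_star\<close>
  zero there, and the quotient below positive.
\<close>

definition energy_efficiency ::
    "real \<Rightarrow> real \<Rightarrow> real \<Rightarrow> real \<Rightarrow> real \<Rightarrow> real \<Rightarrow> real \<Rightarrow> real \<Rightarrow> real \<Rightarrow> real \<Rightarrow> real
      \<Rightarrow> real \<Rightarrow> nat \<Rightarrow> real \<Rightarrow> real" where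
  "energy_efficiency \<alpha> \<omega> \<sigma> \<epsilon> \<eta> \<A> \<C>\<^sub>0 \<C>\<^sub>1 \<D>\<^sub>0 \<D>\<^sub>1 \<gamma> lam K M =
     (if M - real K = sinr_factor \<gamma> \<epsilon> * (2 * real K / (\<alpha> - 2)) then 0
      else real K * \<gamma> /
        (real K * rho_star \<alpha> \<omega> \<sigma> \<epsilon> \<gamma> lam K M / \<eta> + \<C>\<^sub>0 + \<C>\<^sub>1 * real K
         + \<D>\<^sub>0 * M + \<D>\<^sub>1 * M * real K + \<A> * real K * \<gamma>))"

definition M_star ::
    "real \<Rightarrow> real \<Rightarrow> real \<Rightarrow> real \<Rightarrow> real \<Rightarrow> real \<Rightarrow> real \<Rightarrow> real \<Rightarrow> real \<Rightarrow> nat \<Rightarrow> real" where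
  "M_star \<alpha> \<omega> \<sigma> \<epsilon> \<eta> \<D>\<^sub>0 \<D>\<^sub>1 \<gamma> lam K =
     real K + 2 * real K * (2 powr \<gamma> - 1) / ((\<alpha> - 2) * (1 - 2 powr \<gamma> * \<epsilon>\<^sup>2))
     + sqrt (sinr_factor \<gamma> \<epsilon> *
         (real K * inverse \<eta> * \<omega> * \<sigma>\<^sup>2 * Gamma (\<alpha> / 2 + 1)
          / ((pi * lam) powr (\<alpha> / 2) * (\<D>\<^sub>0 + \<D>\<^sub>1 * real K))))"

end

theory Submission
  imports Defs
begin

text \<open>
  Put \<open>x = M - b\<close>, where \<open>b\<close> is the smallest feasible value of \<open>M\<close>. Up to an additive constant the
  denominator of the energy efficiency is \<open>P / x + d * x\<close>, which decreases for \<open>0 < x \<le> sqrt (P / d)\<close>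
  and increases afterwards. With its value 0 at \<open>b\<close>, the energy efficiency is therefore unimodal on
  \<open>{b..}\<close> with peak \<open>b + sqrt (P / d)\<close>, and an optimal integer is one of the neighbours of the peak.
  In the degenerate case \<open>\<gamma> = 0\<close> the energy efficiency vanishes identically.
\<close>

lemma is_arg_max_unimodal:
  fixes F :: "'a::linorder \<Rightarrow> 'b::linorder"
  assumes "b \<le> p" "mono_on {b..p} F" "antimono_on {p..} F"
  shows "is_arg_max F (\<lambda>x. b \<le> x) p"
proof -
  have "F x \<le> F p" if "b \<le> x" for x
  proof (cases "x \<le> p")
    case True
    then show ?thesis using assms that by (intro mono_onD[OF assms(2)]) auto
  next
    case False
    then show ?thesis using monotone_onD[OF assms(3), of p x] by auto
  qed
  then show ?thesis using assms(1) by (simp add: is_arg_max_linorder)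
qed

text \<open>No integer lies strictly between \<lfloor>p\<rfloor> and \<lceil>p\<rceil>, so every
  feasible integer is dominated by \<lfloor>p\<rfloor> on the increasing side or by
  \<lceil>p\<rceil> on the decreasing side.\<close>

lemma is_arg_max_int_unimodal:
  fixes F :: "real \<Rightarrow> 'b::linorder"
  assumes "b \<le> p" "mono_on {b..p} F" "antimono_on {p..} F"
  shows "\<exists>m \<in> {\<lfloor>p\<rfloor>, \<lceil>p\<rceil>}. is_arg_max (\<lambda>n::int. F n) (\<lambda>n. b \<le> real_of_int n) m"
proof -
  have le_floor: "b \<le> real_of_int \<lfloor>p\<rfloor> \<and> F n \<le> F \<lfloor>p\<rfloor>" if "b \<le> real_of_int n" "n \<le> \<lfloor>p\<rfloor>" for n :: int
  proof -
    have "b \<le> real_of_int \<lfloor>p\<rfloor>" "real_of_int n \<le> p"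
      using that by linarith+
    then show ?thesis
      using that by (intro conjI mono_onD[OF assms(2)]) simp_all
  qed
  have le_ceiling: "F n \<le> F \<lceil>p\<rceil>" if "\<lceil>p\<rceil> \<le> n" for n :: int
  proof -
    have "p \<le> real_of_int n"
      using that by linarith
    then show ?thesis
      using that monotone_onD[OF assms(3), of "\<lceil>p\<rceil>" n] by simp
  qed
  have floor_or_ceiling: "n \<le> \<lfloor>p\<rfloor> \<or> \<lceil>p\<rceil> \<le> n" for n :: int
    by linarith
  have feasible_ceiling: "b \<le> real_of_int \<lceil>p\<rceil>"
    using assms(1) by linarith
  show ?thesis
  \<comment> \<open>The floor may fall below \<open>b\<close>. Then \<open>le_floor\<close> rules
    out feasible integers up to \<lfloor>p\<rfloor>, and the ceiling wins whatever value
    \<open>F\<close> takes at the floor.\<close>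
  proof (cases "b \<le> real_of_int \<lfloor>p\<rfloor> \<and> F \<lceil>p\<rceil> \<le> F \<lfloor>p\<rfloor>")
    case True
    then have "F n \<le> F \<lfloor>p\<rfloor>" if "b \<le> real_of_int n" for n :: int
      using le_floor[OF that] le_ceiling[of n] floor_or_ceiling[of n] by auto
    with True show ?thesis by (auto simp: is_arg_max_linorder)
  next
    case False
    then have "F n \<le> F \<lceil>p\<rceil>" if "b \<le> real_of_int n" for n :: int
      using le_floor[OF that] le_ceiling[of n] floor_or_ceiling[of n] by auto
    with feasible_ceiling show ?thesis by (auto simp: is_arg_max_linorder)
  qed
qed

text \<open>Replaces a derivative argument: for positive \<open>t \<le> u\<close> the sign of the
  difference is that of \<open>P - d * (t * u)\<close>, or the difference is 0, so it remains to
  compare \<open>t * u\<close> with the square of the critical point.\<close>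

lemma divide_add_mult_diff:
  fixes t u P d :: real
  assumes "t \<noteq> 0" "u \<noteq> 0"
  shows "(P / t + d * t) - (P / u + d * u) = (u - t) * (P - d * (t * u)) / (t * u)"
  using assms by (simp add: field_simps)

text \<open>Left of the critical point \<open>r\<close>, where \<open>d * r\<^sup>2 = P\<close>, the
  product \<open>t * u\<close> is at most \<open>r\<^sup>2\<close>, which makes the factor
  \<open>P - d * (t * u)\<close> nonnegative.\<close>

lemma divide_add_mult_antimono:
  fixes P d r :: real
  assumes "0 \<le> d" "d * r\<^sup>2 = P" "0 < t" "t \<le> u" "u \<le> r"
  shows "P / u + d * u \<le> P / t + d * t"
proof -
  have "t * u \<le> r\<^sup>2"
    unfolding power2_eq_square using assms by (intro mult_mono) auto
  then have "d * (t * u) \<le> P"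
    using assms(1,2) by (metis mult_left_mono)
  then have "0 \<le> (u - t) * (P - d * (t * u)) / (t * u)"
    using assms by simp
  then show ?thesis
    using divide_add_mult_diff[of t u P d] assms by simp
qed

lemma divide_add_mult_mono:
  fixes P d r :: real
  assumes "0 \<le> d" "d * r\<^sup>2 = P" "0 < r" "r \<le> t" "t \<le> u"
  shows "P / t + d * t \<le> P / u + d * u"
proof -
  have "r\<^sup>2 \<le> t * u"
    unfolding power2_eq_square using assms by (intro mult_mono) auto
  then have "P \<le> d * (t * u)"
    using assms(1,2) by (metis mult_left_mono)
  then have "(u - t) * (P - d * (t * u)) / (t * u) \<le> 0"
    using assms by (intro divide_nonpos_pos mult_nonneg_nonpos) auto
  then show ?thesis
    using divide_add_mult_diff[of t u P d] assms by simp
qed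

text \<open>For positive \<epsilon> the product \<open>2 powr \<gamma> * \<epsilon>\<^sup>2\<close>
  is 2 to the power \<open>\<gamma> + 2 * log 2 \<epsilon>\<close>, a negative exponent.\<close>

lemma sinr_factor_denominator_pos:
  assumes "0 \<le> \<epsilon>" "\<epsilon> = 0 \<or> \<gamma> < - 2 * log 2 \<epsilon>"
  shows "0 < 1 - 2 powr \<gamma> * \<epsilon>\<^sup>2"
proof (cases "\<epsilon> = 0")
  case False
  then have pos: "0 < \<epsilon>" and "\<gamma> + 2 * log 2 \<epsilon> < 0"
    using assms by auto
  then have "2 powr (\<gamma> + 2 * log 2 \<epsilon>) < 2 powr 0"
    by (subst powr_less_cancel_iff) auto
  moreover have "2 powr (2 * log 2 \<epsilon>) = \<epsilon>\<^sup>2"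
    using pos by (simp add: log_powr[symmetric] powr_numeral)
  ultimately show ?thesis
    by (simp add: powr_add)
qed simp

theorem theorem3:
  fixes \<alpha> \<omega> \<sigma> \<epsilon> \<eta> \<A> \<C>\<^sub>0 \<C>\<^sub>1 \<D>\<^sub>0 \<D>\<^sub>1 \<gamma> lam :: real
    and K :: nat
  assumes "\<alpha> > 2" and "\<omega> > 0" and "\<sigma>\<^sup>2 > 0"
    and "0 \<le> \<epsilon>" and "\<epsilon> < 1"
    and "0 < \<eta>" and "\<eta> \<le> 1"
    and "\<A> > 0" and "\<C>\<^sub>0 > 0" and "\<C>\<^sub>1 > 0" and "\<D>\<^sub>0 > 0" and "\<D>\<^sub>1 > 0"
    and "0 \<le> \<gamma>" and "\<epsilon> = 0 \<or> \<gamma> < - 2 * log 2 \<epsilon>"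
    and "lam > 0" and "K > 0"
  shows "let F = energy_efficiency \<alpha> \<omega> \<sigma> \<epsilon> \<eta> \<A> \<C>\<^sub>0 \<C>\<^sub>1 \<D>\<^sub>0 \<D>\<^sub>1 \<gamma> lam K;
             feas = feasible \<alpha> \<epsilon> \<gamma> K;
             Mopt = M_star \<alpha> \<omega> \<sigma> \<epsilon> \<eta> \<D>\<^sub>0 \<D>\<^sub>1 \<gamma> lam K
         in is_arg_max F feas Mopt \<and>
            (Mopt \<notin> \<int> \<longrightarrow>
              (\<exists>m \<in> {\<lfloor>Mopt\<rfloor>, \<lceil>Mopt\<rceil>}.
                 is_arg_max (\<lambda>n::int. F (real_of_int n)) (\<lambda>n. feas (real_of_int n)) m))"
proof -
  define F where "F = energy_efficiency \<alpha> \<omega> \<sigma> \<epsilon> \<eta> \<A> \<C>\<^sub>0 \<C>\<^sub>1 \<D>\<^sub>0 \<D>\<^sub>1 \<gamma> lam K"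
  define s where "s = sinr_factor \<gamma> \<epsilon>"
  define b where "b = real K + s * (2 * real K / (\<alpha> - 2))"
  define d where "d = \<D>\<^sub>0 + \<D>\<^sub>1 * real K"
  define P where "P = real K / \<eta> * (s * (\<omega> * \<sigma>\<^sup>2 * Gamma (\<alpha> / 2 + 1) / (pi * lam) powr (\<alpha> / 2)))"
  \<comment> \<open>The summand \<open>d * b\<close> compensates for writing the antenna cost
    \<open>d * x\<close> as \<open>d * (x - b)\<close>.\<close>
  define c where "c = \<C>\<^sub>0 + \<C>\<^sub>1 * real K + \<A> * real K * \<gamma> + d * b"
  define r where "r = sqrt (P / d)"
  have denom_pos: "0 < 1 - 2 powr \<gamma> * \<epsilon>\<^sup>2"
    using assms by (intro sinr_factor_denominator_pos) auto
  have "0 \<le> s"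
    unfolding s_def sinr_factor_def using denom_pos assms by (simp add: ge_one_powr_ge_zero)
  have "0 < d"
    unfolding d_def using assms by (simp add: add_pos_pos)
  have "0 < Gamma (\<alpha> / 2 + 1)"
    using assms by (intro Gamma_real_pos) simp
  have "0 \<le> P"
    unfolding P_def using assms \<open>0 \<le> s\<close> \<open>0 < Gamma (\<alpha> / 2 + 1)\<close> by simp
  have "0 \<le> r"
    unfolding r_def using \<open>0 \<le> P\<close> \<open>0 < d\<close> by simp
  have dr: "d * r\<^sup>2 = P"
    unfolding r_def using \<open>0 \<le> P\<close> \<open>0 < d\<close> by simp
  have "0 \<le> b"
    unfolding b_def using assms \<open>0 \<le> s\<close> by simp
  have "0 < c"
    unfolding c_def using assms \<open>0 \<le> b\<close> \<open>0 < d\<close> by (simp add: add_pos_nonneg)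
  have feas: "feasible \<alpha> \<epsilon> \<gamma> K = (\<lambda>x. b \<le> x)"
    by (auto simp: fun_eq_iff feasible_def b_def s_def)
  have Mopt: "M_star \<alpha> \<omega> \<sigma> \<epsilon> \<eta> \<D>\<^sub>0 \<D>\<^sub>1 \<gamma> lam K = b + r"
  proof -
    have "2 * real K * (2 powr \<gamma> - 1) / ((\<alpha> - 2) * (1 - 2 powr \<gamma> * \<epsilon>\<^sup>2)) = s * (2 * real K / (\<alpha> - 2))"
      by (simp only: s_def sinr_factor_def times_divide_times_eq mult_ac)
    moreover have "s * (real K * inverse \<eta> * \<omega> * \<sigma>\<^sup>2 * Gamma (\<alpha> / 2 + 1)
        / ((pi * lam) powr (\<alpha> / 2) * (\<D>\<^sub>0 + \<D>\<^sub>1 * real K))) = P / d"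
      by (simp only: P_def d_def divide_inverse inverse_mult_distrib mult_ac)
    ultimately show ?thesis
      by (simp add: M_star_def b_def r_def s_def[symmetric])
  qed
  have F_b: "F b = 0"
    by (simp add: F_def energy_efficiency_def b_def s_def)
  have F_eq: "F x = real K * \<gamma> / (P / (x - b) + d * (x - b) + c)" if "x \<noteq> b" for x
  proof -
    have "real K * rho_star \<alpha> \<omega> \<sigma> \<epsilon> \<gamma> lam K x / \<eta> = P / (x - b)"
      by (simp add: rho_star_def P_def b_def s_def[symmetric] diff_diff_eq)
    moreover have "\<D>\<^sub>0 * x + \<D>\<^sub>1 * x * real K = d * (x - b) + d * b"
      by (simp add: d_def algebra_simps)
    moreover have "x - real K \<noteq> sinr_factor \<gamma> \<epsilon> * (2 * real K / (\<alpha> - 2))"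
      using that by (auto simp: b_def s_def)
    ultimately show ?thesis
      by (simp add: F_def energy_efficiency_def c_def add_ac)
  qed
  \<comment> \<open>This includes \<open>x = b\<close>, where \<open>P / 0 = 0\<close> leaves just
    \<open>c\<close>.\<close>
  have g_pos: "0 < P / (x - b) + d * (x - b) + c" if "b \<le> x" for x
    using that \<open>0 \<le> P\<close> \<open>0 < d\<close> \<open>0 < c\<close> by (simp add: add_nonneg_pos)
  have F_le: "F x \<le> F y"
    if "b < x" "b < y" "P / (y - b) + d * (y - b) \<le> P / (x - b) + d * (x - b)" for x y
    using that g_pos[of y] \<open>0 \<le> \<gamma>\<close> by (simp add: F_eq frac_le)
  have F_nonneg: "0 \<le> F x" if "b \<le> x" for x
    using F_b F_eq[of x] g_pos[OF that] \<open>0 \<le> \<gamma>\<close> by (cases "x = b") auto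
  have mono: "mono_on {b..b + r} F"
  proof (rule mono_onI)
    fix x y assume xy: "x \<in> {b..b + r}" "y \<in> {b..b + r}" "x \<le> y"
    show "F x \<le> F y"
    proof (cases "x = b")
      case True
      then show ?thesis using F_b F_nonneg[of y] xy by simp
    next
      case False
      then show ?thesis
        using xy \<open>0 < d\<close> dr by (intro F_le divide_add_mult_antimono[of d r]) auto
    qed
  qed
  have anti: "antimono_on {b + r..} F"
  \<comment> \<open>If \<gamma> = 0, then \<open>r = 0\<close> and the half-line starts at
    \<open>b\<close> itself, outside the reach of \<open>F_le\<close>. For positive \<gamma> the
    peak lies strictly to the right of \<open>b\<close>.\<close>
  proof (cases "\<gamma> = 0")
    case True
    then have "F x = 0" for x
      by (simp add: F_def energy_efficiency_def)
    then show ?thesis by (simp add: monotone_on_def)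
  next
    case False
    then have "1 < 2 powr \<gamma>"
      using \<open>0 \<le> \<gamma>\<close> by simp
    then have "0 < s"
      unfolding s_def sinr_factor_def using denom_pos by simp
    then have "0 < r"
      unfolding r_def P_def using assms \<open>0 < Gamma (\<alpha> / 2 + 1)\<close> \<open>0 < d\<close> by simp
    show ?thesis
    proof (rule monotone_onI)
      fix x y assume "x \<in> {b + r..}" "y \<in> {b + r..}" "x \<le> y"
      then show "F y \<le> F x"
        using \<open>0 < r\<close> \<open>0 < d\<close> dr by (intro F_le divide_add_mult_mono[of d r]) auto
    qed
  qed
  have b_le: "b \<le> b + r"
    using \<open>0 \<le> r\<close> by simp
  show ?thesis
    unfolding Let_def F_def[symmetric] feas Mopt
    using is_arg_max_unimodal[OF b_le mono anti] is_arg_max_int_unimodal[OF b_le mono anti]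
    by simp
qed

end
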